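(* Let $\mathcal E$ be a family in some Boolean algebra $\mathfrak A$ such that $\mathcal E$ contains no infinite independent sequence. Let, for a fixed $r$, $p(x_1,x_2,\ldots,x_r)$ be any Boolean polynomial. Then the family $$p(\mathcal E)=\{p(a_1,\ldots,a_r): a_1,\ldots,a_r\in\mathcal E\}$$ contains no infinite independent sequence.
   Context: A family $\{a_i:i\in I\}$ in a Boolean algebra is independent if $\bigcap_{i\in I'}a_i\cap\bigcap_{i\in I''}a_i^c\neq 0$ for all finite disjoint $I',I''\subseteq I$. A Boolean polynomial $p(x_1,\dots,x_r)$ is an expression built from the variables by the operations of meet, join and complement. *)

theory Defs
  imports Main
begin

text \<open>
  The meet of a finite, possibly empty, set: adjoining the top element changes no meet and
  makes the empty meet equal to the top element.
\<close>

definition finite_meet :: "'a::boolean_algebra set \<Rightarrow> 'a" where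
  "finite_meet A = Inf_fin (insert top A)"

definition independent_family :: "'i set \<Rightarrow> ('i \<Rightarrow> 'a::boolean_algebra) \<Rightarrow> bool" where
  "independent_family I a \<longleftrightarrow>
     (\<forall>I' I''. finite I' \<and> finite I'' \<and> I' \<subseteq> I \<and> I'' \<subseteq> I \<and> I' \<inter> I'' = {} \<longrightarrow>
        inf (finite_meet (a ` I')) (finite_meet ((\<lambda>i. - a i) ` I'')) \<noteq> bot)"

text \<open>
  An independent family is injective on its index set (otherwise some
  \<open>inf (a i) (- a j)\<close> would vanish), so a sequence as below always has infinitely many
  distinct members.
\<close>

definition contains_infinite_independent_sequence :: "'a::boolean_algebra set \<Rightarrow> bool" where
  "contains_infinite_independent_sequence E \<longleftrightarrow>
     (\<exists>s :: nat \<Rightarrow> 'a. range s \<subseteq> E \<and> independent_family UNIV s)"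

text \<open>
  There are no constants among the expressions. Hence there is no polynomial in zero variables.
\<close>

datatype (poly_vars: 'v) bool_poly =
    Var 'v
  | Meet "'v bool_poly" "'v bool_poly"
  | Join "'v bool_poly" "'v bool_poly"
  | Compl "'v bool_poly"

primrec poly_eval :: "'v bool_poly \<Rightarrow> ('v \<Rightarrow> 'a::boolean_algebra) \<Rightarrow> 'a" where
  "poly_eval (Var v) a = a v"
| "poly_eval (Meet p q) a = inf (poly_eval p a) (poly_eval q a)"
| "poly_eval (Join p q) a = sup (poly_eval p a) (poly_eval q a)"
| "poly_eval (Compl p) a = - poly_eval p a"

text \<open>
  For a polynomial with variables among \<open>1, \<dots>, r\<close>, the values of the assignment \<open>a\<close>
  outside \<open>{1..r}\<close> play no role.
\<close>

definition poly_image :: "nat \<Rightarrow> nat bool_poly \<Rightarrow> 'a::boolean_algebra set \<Rightarrow> 'a set" where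
  "poly_image r p E = {poly_eval p a | a. \<forall>i\<in>{1..r}. a i \<in> E}"

end

theory Submission
  imports Defs "HOL-Library.Infinite_Set"
begin

text \<open>
  Identify an element \<open>x\<close> of the Boolean algebra with the set of ultrafilters containing it, as in
  Stone duality. Two facts about sequences of sets carry the proof.

  The first is the set version of Rosenthal's \<open>\<ell>\<^sub>1\<close> dichotomy: a sequence of subsets of a set \<open>S\<close>
  has an independent subsequence or a subsequence whose indicator functions converge at every
  point of \<open>S\<close> (\<open>rosenthal_dichotomy\<close>).

  The second is that an independent sequence has no pointwise convergent subsequence: by
  compactness there is an ultrafilter that contains every other member of the subsequence and
  omits the rest.

  Now let \<open>b\<^sub>n = p(a\<^sub>n\<^sub>1, \<dots>, a\<^sub>n\<^sub>r)\<close> with all \<open>a\<^sub>n\<^sub>i\<close> in \<open>\<E>\<close>. If \<open>\<E>\<close> contains no infinite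
  independent sequence, then applying the dichotomy once for each \<open>i\<close> gives one infinite index
  set along which all \<open>r\<close> sequences converge pointwise. Boolean operations preserve pointwise
  convergence of indicator functions, so \<open>b\<^sub>n\<close> converges along the same index set, and is
  therefore not independent.
\<close>

section \<open>Finite meets and ultrafilters\<close>

lemma le_finite_meet_iff:
  assumes "finite A"
  shows "x \<le> finite_meet A \<longleftrightarrow> (\<forall>a\<in>A. x \<le> a)"
  using assms unfolding finite_meet_def by (simp add: Inf_fin.bounded_iff)

lemma finite_meet_le: "finite A \<Longrightarrow> a \<in> A \<Longrightarrow> finite_meet A \<le> a"
  using le_finite_meet_iff[of A "finite_meet A"] by blast

lemma finite_meet_Un:
  "finite A \<Longrightarrow> finite B \<Longrightarrow> finite_meet (A \<union> B) = inf (finite_meet A) (finite_meet B)"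
  by (rule antisym) (auto simp: le_finite_meet_iff intro: le_infI1 le_infI2 finite_meet_le)

definition finite_meet_property :: "'a::boolean_algebra set \<Rightarrow> bool" where
  "finite_meet_property G \<longleftrightarrow> (\<forall>H\<subseteq>G. finite H \<longrightarrow> finite_meet H \<noteq> bot)"

text \<open>
  An ultrafilter is encoded as a set whose membership predicate commutes with meet and
  complement, that is, as a homomorphism to the two-element algebra.
\<close>

definition ultrafilters :: "'a::boolean_algebra set set" where
  "ultrafilters =
     {F. (\<forall>x y. inf x y \<in> F \<longleftrightarrow> x \<in> F \<and> y \<in> F) \<and> (\<forall>x. - x \<in> F \<longleftrightarrow> x \<notin> F)}"

lemma
  assumes "F \<in> ultrafilters"
  shows ultrafilter_inf: "inf x y \<in> F \<longleftrightarrow> x \<in> F \<and> y \<in> F"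
    and ultrafilter_compl: "- x \<in> F \<longleftrightarrow> x \<notin> F"
  using assms unfolding ultrafilters_def by auto

lemma ultrafilter_bot: "F \<in> ultrafilters \<Longrightarrow> bot \<notin> F"
  using ultrafilter_inf[of F bot "- bot"] ultrafilter_compl[of F bot] by auto

lemma ultrafilter_sup:
  assumes "F \<in> ultrafilters"
  shows "sup x y \<in> F \<longleftrightarrow> x \<in> F \<or> y \<in> F"
proof -
  have "sup x y = - inf (- x) (- y)"
    by simp
  then show ?thesis
    by (simp only: ultrafilter_inf[OF assms] ultrafilter_compl[OF assms]) blast
qed

lemma ultrafilter_finite_meet:
  assumes "F \<in> ultrafilters" and "finite A" and "A \<subseteq> F"
  shows "finite_meet A \<in> F"
  using assms(2,3)
proof (induction A)
  case empty
  have "finite_meet {} = - (bot :: 'a)"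
    by (simp add: finite_meet_def)
  then show ?case
    by (simp only: ultrafilter_compl[OF assms(1)] ultrafilter_bot[OF assms(1)]) simp
next
  case (insert x A)
  have "finite_meet (insert x A) = inf x (finite_meet A)"
    using insert.hyps finite_meet_Un[of "{x}" A] by (simp add: finite_meet_def)
  then show ?case
    using insert ultrafilter_inf[OF assms(1)] by simp
qed

text \<open>
  The Boolean prime ideal theorem. By Zorn's lemma there is a maximal set \<open>F \<supseteq> G\<close> with the finite
  meet property. Maximality forces \<open>F\<close> to contain everything above one of its finite meets,
  because adding such an element creates no vanishing meet. So \<open>F\<close> is a filter, and it decides
  every \<open>x\<close>: if \<open>x\<close> cannot be added, then some finite meet from \<open>F\<close> lies below \<open>- x\<close>.
\<close>

lemma ultrafilter_extension:
  assumes "finite_meet_property G"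
  obtains F where "F \<in> ultrafilters" and "G \<subseteq> F"
proof -
  let ?P = "{F. finite_meet_property F \<and> G \<subseteq> F}"
  have "\<exists>F\<in>?P. \<forall>X\<in>?P. F \<subseteq> X \<longrightarrow> X = F"
  proof (rule subset_Zorn_nonempty)
    show "?P \<noteq> {}"
      using assms by auto
  next
    fix C assume C: "C \<noteq> {}" "subset.chain ?P C"
    have "finite_meet H \<noteq> bot" if H: "H \<subseteq> \<Union>C" "finite H" for H
    proof -
      obtain X where "X \<in> C" "H \<subseteq> X"
        using finite_subset_Union_chain[OF H(2,1) C] by blast
      moreover have "C \<subseteq> ?P"
        using C(2) unfolding subset_chain_def by (rule conjunct1)
      ultimately have "finite_meet_property X"
        by blast
      then show ?thesis
        using \<open>H \<subseteq> X\<close> H(2) unfolding finite_meet_property_def by blast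
    qed
    moreover have "G \<subseteq> \<Union>C"
      using C unfolding subset_chain_def by blast
    ultimately show "\<Union>C \<in> ?P"
      by (simp add: finite_meet_property_def)
  qed
  then obtain F where fip: "finite_meet_property F" and "G \<subseteq> F"
    and max: "\<And>X. finite_meet_property X \<Longrightarrow> F \<subseteq> X \<Longrightarrow> X = F"
    by (smt (verit) mem_Collect_eq subset_trans)
  have up: "y \<in> F" if H: "H \<subseteq> F" "finite H" "finite_meet H \<le> y" for H y
  proof -
    have "finite_meet K \<noteq> bot" if K: "K \<subseteq> insert y F" "finite K" for K
    proof
      assume "finite_meet K = bot"
      moreover have "finite_meet ((K - {y}) \<union> H) \<le> finite_meet K"
        using H K by (subst le_finite_meet_iff)
          (auto simp: finite_meet_Un intro: le_infI1 le_infI2 finite_meet_le)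
      ultimately have "finite_meet ((K - {y}) \<union> H) = bot"
        by (simp add: bot_unique)
      moreover have "(K - {y}) \<union> H \<subseteq> F" "finite ((K - {y}) \<union> H)"
        using H K by auto
      ultimately show False
        using fip unfolding finite_meet_property_def by blast
    qed
    then have "insert y F = F"
      by (intro max) (auto simp: finite_meet_property_def)
    then show ?thesis by blast
  qed
  have inf: "inf x y \<in> F \<longleftrightarrow> x \<in> F \<and> y \<in> F" for x y
  proof
    assume "inf x y \<in> F"
    moreover have "finite_meet {inf x y} \<le> inf x y"
      by (rule finite_meet_le) simp_all
    ultimately show "x \<in> F \<and> y \<in> F"
      using up[of "{inf x y}" x] up[of "{inf x y}" y] by simp
  next
    assume "x \<in> F \<and> y \<in> F"
    moreover have "finite_meet {x, y} \<le> inf x y"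
      by (simp add: finite_meet_le)
    ultimately show "inf x y \<in> F"
      using up[of "{x, y}" "inf x y"] by simp
  qed
  have "- x \<notin> F" if "x \<in> F" for x
  proof
    assume "- x \<in> F"
    with that have "finite_meet {x, - x} \<noteq> bot"
      using fip by (simp add: finite_meet_property_def)
    moreover have "finite_meet {x, - x} \<le> inf x (- x)"
      by (rule le_infI) (rule finite_meet_le; simp)+
    ultimately show False
      by (simp add: bot_unique)
  qed
  moreover have "- x \<in> F" if "x \<notin> F" for x
  proof -
    have "\<not> finite_meet_property (insert x F)"
      using max[of "insert x F"] that by blast
    then obtain K where K: "K \<subseteq> insert x F" "finite K" "finite_meet K = bot"
      unfolding finite_meet_property_def by blast
    have "inf (finite_meet (K - {x})) x \<le> finite_meet K"
      using K by (subst le_finite_meet_iff) (auto intro: le_infI1 le_infI2 finite_meet_le)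
    then have "finite_meet (K - {x}) \<le> - x"
      using K by (simp add: bot_unique inf_shunt)
    then show ?thesis
      using K up[of "K - {x}" "- x"] by blast
  qed
  ultimately have "F \<in> ultrafilters"
    unfolding ultrafilters_def using inf by blast
  with \<open>G \<subseteq> F\<close> show thesis
    using that by blast
qed

section \<open>Independence in terms of ultrafilters\<close>

text \<open>
  Compactness of the Stone space: finitely many prescriptions are compatible by independence,
  hence all of them are.
\<close>

lemma independent_family_ultrafilter:
  assumes "independent_family UNIV b"
  obtains F where "F \<in> ultrafilters" and "\<And>n. b n \<in> F \<longleftrightarrow> n \<in> P"
proof -
  let ?G = "b ` P \<union> (\<lambda>n. - b n) ` (- P)"
  have "finite_meet H \<noteq> bot" if HG: "H \<subseteq> ?G" "finite H" for H
  proof -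
    obtain H1 H2 where H: "H = H1 \<union> H2" "H1 \<subseteq> b ` P" "H2 \<subseteq> (\<lambda>n. - b n) ` (- P)"
      using subset_UnE[OF HG(1)] by metis
    with HG have fin: "finite H1" "finite H2" by auto
    obtain I1 where I1: "I1 \<subseteq> P" "finite I1" "H1 = b ` I1"
      using finite_subset_image[OF fin(1) H(2)] by blast
    obtain I2 where I2: "I2 \<subseteq> - P" "finite I2" "H2 = (\<lambda>n. - b n) ` I2"
      using finite_subset_image[OF fin(2) H(3)] by blast
    have "I1 \<inter> I2 = {}"
      using I1 I2 by blast
    then show ?thesis
      using assms I1 I2 fin unfolding independent_family_def H(1)
      by (simp add: finite_meet_Un)
  qed
  then have "finite_meet_property ?G"
    unfolding finite_meet_property_def by blast
  then obtain F where F: "F \<in> ultrafilters" "?G \<subseteq> F"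
    by (rule ultrafilter_extension)
  then have "b n \<in> F \<longleftrightarrow> n \<in> P" for n
    using ultrafilter_compl[OF F(1)] by blast
  with F that show thesis by blast
qed

lemma independent_familyI:
  assumes "\<And>\<sigma> k. \<exists>F\<in>ultrafilters. \<forall>i<k. b i \<in> F \<longleftrightarrow> \<sigma> i"
  shows "independent_family UNIV (b :: nat \<Rightarrow> 'a::boolean_algebra)"
  unfolding independent_family_def
proof (intro allI impI, elim conjE)
  fix I J :: "nat set"
  assume IJ: "finite I" "finite J" "I \<inter> J = {}"
  then obtain k where k: "\<And>i. i \<in> I \<union> J \<Longrightarrow> i < k"
    using finite_nat_set_iff_bounded[of "I \<union> J"] by auto
  obtain F where F: "F \<in> ultrafilters" "\<And>i. i < k \<Longrightarrow> b i \<in> F \<longleftrightarrow> i \<in> I"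
    using assms[of k "\<lambda>i. i \<in> I"] by blast
  have "b ` I \<subseteq> F"
    using k F(2) by blast
  moreover have "(\<lambda>i. - b i) ` J \<subseteq> F"
    using k F(2) IJ(3) ultrafilter_compl[OF F(1)] by blast
  ultimately have "inf (finite_meet (b ` I)) (finite_meet ((\<lambda>i. - b i) ` J)) \<in> F"
    using IJ F(1) by (simp add: ultrafilter_inf ultrafilter_finite_meet)
  then show "inf (finite_meet (b ` I)) (finite_meet ((\<lambda>i. - b i) ` J)) \<noteq> bot"
    using ultrafilter_bot[OF F(1)] by auto
qed

section \<open>Rosenthal's dichotomy for sequences of sets\<close>

text \<open>
  This is pointwise convergence on \<open>X\<close> of the indicator functions of \<open>A n\<close> along \<open>n \<in> M\<close>: a
  sequence of zeros and ones converges iff it is eventually constant.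
\<close>

definition converges_on :: "(nat \<Rightarrow> 'x set) \<Rightarrow> nat set \<Rightarrow> 'x set \<Rightarrow> bool" where
  "converges_on A M X \<longleftrightarrow> (\<forall>x\<in>X. finite {n\<in>M. x \<in> A n} \<or> finite {n\<in>M. x \<notin> A n})"

definition hereditarily_divergent :: "(nat \<Rightarrow> 'x set) \<Rightarrow> nat set \<Rightarrow> 'x set \<Rightarrow> bool" where
  "hereditarily_divergent A M X \<longleftrightarrow> (\<forall>M'\<subseteq>M. infinite M' \<longrightarrow> \<not> converges_on A M' X)"

lemma converges_on_almost_subset:
  assumes "converges_on A M X" and "finite (M' - M)"
  shows "converges_on A M' X"
  unfolding converges_on_def
proof
  fix x assume "x \<in> X"
  have *: "finite {n\<in>M'. Q n}" if "finite {n\<in>M. Q n}" for Q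
    by (rule finite_subset[of _ "{n\<in>M. Q n} \<union> (M' - M)"]) (use that assms(2) in auto)
  show "finite {n\<in>M'. x \<in> A n} \<or> finite {n\<in>M'. x \<notin> A n}"
    using assms(1) \<open>x \<in> X\<close> *[of "\<lambda>n. x \<in> A n"] *[of "\<lambda>n. x \<notin> A n"] unfolding converges_on_def by blast
qed

lemma hereditarily_divergent_nonempty:
  "hereditarily_divergent A M X \<Longrightarrow> infinite M \<Longrightarrow> X \<noteq> {}"
  by (auto simp: hereditarily_divergent_def converges_on_def)

text \<open>
  One member of the sequence can split all the cells of a finite family so that both halves of
  every cell stay hereditarily divergent. Suppose not. Then for each \<open>n\<close> any index set can be
  thinned so that convergence holds on some half cell cut out by \<open>A n\<close>. Diagonalising, and
  choosing one cell \<open>X\<close> and one side that occur infinitely often, gives indices \<open>N\<close> along which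
  the sequence converges on the chosen side of \<open>A n\<close> in \<open>X\<close>, for every \<open>n \<in> N\<close>. A point of \<open>X\<close> on
  none of these sides is on the opposite side of every \<open>A n\<close> with \<open>n \<in> N\<close>, so there the sequence
  is constant. Hence it converges on the whole of \<open>X\<close>, a contradiction.
\<close>

lemma split_hereditarily_divergent:
  assumes "finite \<X>" and "infinite M"
    and hd: "\<And>X. X \<in> \<X> \<Longrightarrow> hereditarily_divergent A M X"
  shows "\<exists>n. \<exists>M'\<subseteq>M. infinite M' \<and> (\<forall>X\<in>\<X>. hereditarily_divergent A M' (X \<inter> A n) \<and>
    hereditarily_divergent A M' (X - A n))"
proof (rule ccontr)
  assume no_split: "\<not> ?thesis"
  \<comment> \<open>A half cell is named by its cell and the side of \<open>A n\<close>; there are finitely many names,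
    whatever \<open>n\<close> is, so the pigeonhole principle applies to them.\<close>
  define half where "half n c = {x \<in> fst c. x \<in> A n \<longleftrightarrow> snd c}" for n c
  have half_simps: "half n (X, True) = X \<inter> A n" "half n (X, False) = X - A n" for n X
    by (auto simp: half_def)
  have thin: "\<exists>c\<in>\<X> \<times> UNIV. \<exists>M''\<subseteq>M'. infinite M'' \<and> converges_on A M'' (half n c)"
    if M': "infinite M'" "M' \<subseteq> M" for n M'
  proof (rule ccontr)
    assume "\<not> ?thesis"
    then have hd_half: "hereditarily_divergent A M' (half n (X, e))" if "X \<in> \<X>" for X e
      using that unfolding hereditarily_divergent_def by blast
    have "\<forall>X\<in>\<X>. hereditarily_divergent A M' (X \<inter> A n) \<and> hereditarily_divergent A M' (X - A n)"
    proof
      fix X assume "X \<in> \<X>"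
      then show "hereditarily_divergent A M' (X \<inter> A n) \<and> hereditarily_divergent A M' (X - A n)"
        using hd_half[of X True] hd_half[of X False] by (simp add: half_simps)
    qed
    with no_split M' show False by blast
  qed
  \<comment> \<open>The state is the current index, the half chosen for it, and the index set left after it.\<close>
  define good where "good s \<longleftrightarrow> (case s of (n, c, L) \<Rightarrow>
      c \<in> \<X> \<times> UNIV \<and> infinite L \<and> L \<subseteq> M \<and> converges_on A L (half n c))"
    for s :: "nat \<times> ('a set \<times> bool) \<times> nat set"
  define next_state where "next_state s t \<longleftrightarrow> fst s < fst t \<and> fst t \<in> snd (snd s) \<and>
      snd (snd t) \<subseteq> snd (snd s)"
    for s t :: "nat \<times> ('a set \<times> bool) \<times> nat set"
  have "\<exists>f. \<forall>k::nat. good (f k) \<and> next_state (f k) (f (Suc k))"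
  proof (rule dependent_nat_choice)
    obtain c L where "c \<in> \<X> \<times> UNIV" "L \<subseteq> M" "infinite L" "converges_on A L (half 0 c)"
      using thin[OF \<open>infinite M\<close> order_refl, of 0] by blast
    then show "\<exists>s. good s"
      unfolding good_def by (intro exI[of _ "(0, c, L)"]) simp
  next
    fix s :: "nat \<times> ('a set \<times> bool) \<times> nat set" and k :: nat
    assume "good s"
    then obtain n c L where s: "s = (n, c, L)" and L: "infinite L" "L \<subseteq> M"
      unfolding good_def by (cases s) auto
    obtain m where m: "n < m" "m \<in> L"
      using L(1) infinite_nat_iff_unbounded[of L] by blast
    obtain d L' where "d \<in> \<X> \<times> UNIV" "L' \<subseteq> L" "infinite L'" "converges_on A L' (half m d)"
      using thin[OF L, of m] by blast
    with m L(2) show "\<exists>t. good t \<and> next_state s t"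
      unfolding good_def next_state_def s by (intro exI[of _ "(m, d, L')"]) auto
  qed
  then obtain f where f: "\<And>k. good (f k)" "\<And>k. next_state (f k) (f (Suc k))"
    by blast
  define \<nu> c L where "\<nu> = fst \<circ> f" and "c = fst \<circ> snd \<circ> f" and "L = snd \<circ> snd \<circ> f"
  have c: "c k \<in> \<X> \<times> UNIV" and L_M: "L k \<subseteq> M"
    and conv: "converges_on A (L k) (half (\<nu> k) (c k))" for k
    using f(1)[of k] by (auto simp: good_def \<nu>_def c_def L_def split: prod.splits)
  have mono: "strict_mono \<nu>"
    using f(2) by (auto simp: strict_mono_Suc_iff next_state_def \<nu>_def)
  have "L k \<supseteq> L (k + j)" for k j
    by (induction j) (use f(2) in \<open>auto simp: next_state_def L_def\<close>)
  moreover have "\<nu> (Suc k) \<in> L k" for k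
    using f(2)[of k] by (auto simp: next_state_def \<nu>_def L_def)
  ultimately have \<nu>_L: "\<nu> j \<in> L k" if "k < j" for k j
    using that less_imp_Suc_add[OF that] by fastforce
  have "\<exists>k0\<in>UNIV. infinite {k \<in> UNIV. c k = c k0}"
  proof (rule pigeonhole_infinite)
    show "finite (range c)"
      by (rule finite_subset[OF image_subsetI[OF c]]) (simp add: \<open>finite \<X>\<close>)
  qed simp
  then obtain k0 where K0: "infinite {k. c k = c k0}"
    by auto
  obtain X e where Xe: "c k0 = (X, e)" "X \<in> \<X>"
    using c[of k0] by auto
  \<comment> \<open>The initial index is arbitrary and may lie outside \<open>M\<close>, so it is dropped.\<close>
  define K where "K = {k. c k = c k0} - {0}"
  have "infinite K"
    using K0 by (simp add: K_def)
  define N where "N = \<nu> ` K"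
  have "infinite N"
    using \<open>infinite K\<close> strict_mono_imp_inj_on[OF mono]
    unfolding N_def by (metis finite_imageD inj_on_subset subset_UNIV)
  have "N \<subseteq> M"
    unfolding N_def K_def using \<nu>_L[of 0] L_M[of 0] by auto
  have "converges_on A N X"
    unfolding converges_on_def
  proof
    fix x assume "x \<in> X"
    show "finite {n\<in>N. x \<in> A n} \<or> finite {n\<in>N. x \<notin> A n}"
    proof (cases "\<exists>k\<in>K. x \<in> A (\<nu> k) \<longleftrightarrow> e")
      case True
      then obtain k where k: "k \<in> K" "x \<in> A (\<nu> k) \<longleftrightarrow> e" by blast
      have "N - L k \<subseteq> \<nu> ` {..k}"
      proof
        fix n assume "n \<in> N - L k"
        then obtain j where "n = \<nu> j" "\<nu> j \<notin> L k"
          unfolding N_def by blast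
        then show "n \<in> \<nu> ` {..k}"
          using \<nu>_L[of k j] by (cases "k < j") auto
      qed
      then have "finite (N - L k)"
        by (rule finite_subset) simp
      then have "converges_on A N (half (\<nu> k) (c k))"
        using conv converges_on_almost_subset by blast
      moreover have "x \<in> half (\<nu> k) (c k)"
        using k \<open>x \<in> X\<close> Xe by (auto simp: half_def K_def)
      ultimately show ?thesis
        unfolding converges_on_def by blast
    next
      case False
      then have "\<forall>n\<in>N. x \<in> A n \<longleftrightarrow> \<not> e"
        unfolding N_def by blast
      then have "{n\<in>N. x \<in> A n} = {} \<or> {n\<in>N. x \<notin> A n} = {}"
        by blast
      then show ?thesis by (metis finite.emptyI)
    qed
  qed
  with hd[OF Xe(2)] \<open>infinite N\<close> \<open>N \<subseteq> M\<close> show False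
    unfolding hereditarily_divergent_def by blast
qed

text \<open>
  If no subsequence converges, split repeatedly, starting from the single cell \<open>S\<close>. The cells
  after \<open>k\<close> steps are the \<open>2\<^sup>k\<close> intersections with the chosen members or their complements, and
  none of them is empty because each is hereditarily divergent.
\<close>

theorem rosenthal_dichotomy:
  fixes A :: "nat \<Rightarrow> 'x set"
  assumes "infinite M"
  obtains
    (convergent) M' where "infinite M'" "M' \<subseteq> M" "converges_on A M' S"
  | (independent) \<nu> where "\<And>\<sigma> (k::nat). \<exists>x\<in>S. \<forall>i<k. x \<in> A (\<nu> i) \<longleftrightarrow> \<sigma> i"
proof (cases "hereditarily_divergent A M S")
  case False
  then show thesis
    using convergent unfolding hereditarily_divergent_def by blast
next
  case True
  define good where "good s \<longleftrightarrow> (case s of (\<X>, L) \<Rightarrow> finite \<X> \<and> infinite L \<and>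
      (\<forall>X\<in>\<X>. hereditarily_divergent A L X))" for s :: "'x set set \<times> nat set"
  define split where "split n \<X> = (\<lambda>X. X \<inter> A n) ` \<X> \<union> (\<lambda>X. X - A n) ` \<X>" for n \<X>
  have "\<exists>f. \<forall>k::nat. (good (f k) \<and> (k = 0 \<longrightarrow> fst (f k) = {S})) \<and>
      (\<exists>n. fst (f (Suc k)) = split n (fst (f k)))"
  proof (rule dependent_nat_choice)
    show "\<exists>s. good s \<and> (0 = 0 \<longrightarrow> fst s = {S})"
      using True assms by (intro exI[of _ "({S}, M)"]) (simp add: good_def)
  next
    fix s :: "'x set set \<times> nat set" and k :: nat
    assume "good s \<and> (k = 0 \<longrightarrow> fst s = {S})"
    then obtain \<X> L where s: "s = (\<X>, L)" "finite \<X>" "infinite L"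
      "\<And>X. X \<in> \<X> \<Longrightarrow> hereditarily_divergent A L X"
      unfolding good_def by (cases s) auto
    obtain n L' where "infinite L'" "\<forall>X\<in>\<X>. hereditarily_divergent A L' (X \<inter> A n) \<and>
        hereditarily_divergent A L' (X - A n)"
      using split_hereditarily_divergent[OF s(2-4)] by blast
    then have "good (split n \<X>, L')"
      using s(2) by (auto simp: good_def split_def)
    then show "\<exists>t. (good t \<and> (Suc k = 0 \<longrightarrow> fst t = {S})) \<and> (\<exists>n. fst t = split n (fst s))"
      using s(1) by auto
  qed
  then obtain f where all: "\<forall>k. (good (f k) \<and> (k = 0 \<longrightarrow> fst (f k) = {S})) \<and>
      (\<exists>n. fst (f (Suc k)) = split n (fst (f k)))"
    by (rule exE)
  have f: "good (f k)" "fst (f 0) = {S}" "\<exists>n. fst (f (Suc k)) = split n (fst (f k))" for k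
    using all by simp_all
  obtain \<nu> where \<nu>: "\<And>k. fst (f (Suc k)) = split (\<nu> k) (fst (f k))"
    using f(3) by metis
  have cell: "{x\<in>S. \<forall>i<k. x \<in> A (\<nu> i) \<longleftrightarrow> \<sigma> i} \<in> fst (f k)" for \<sigma> k
  proof (induction k)
    case 0
    show ?case using f(2) by simp
  next
    case (Suc k)
    let ?X = "{x\<in>S. \<forall>i<k. x \<in> A (\<nu> i) \<longleftrightarrow> \<sigma> i}"
    have "{x\<in>S. \<forall>i<Suc k. x \<in> A (\<nu> i) \<longleftrightarrow> \<sigma> i} = (if \<sigma> k then ?X \<inter> A (\<nu> k) else ?X - A (\<nu> k))"
      by (auto simp: less_Suc_eq)
    then show ?case
      using Suc \<nu>[of k] by (auto simp: split_def)
  qed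
  have "{x\<in>S. \<forall>i<k. x \<in> A (\<nu> i) \<longleftrightarrow> \<sigma> i} \<noteq> {}" for \<sigma> k
    using cell[of k \<sigma>] f(1)[of k] hereditarily_divergent_nonempty
    by (fastforce simp: good_def split: prod.splits)
  then show thesis
    by (intro independent[of \<nu>]) blast
qed

section \<open>Boolean polynomials of convergent sequences\<close>

abbreviation stone :: "'a::boolean_algebra \<Rightarrow> 'a set set" where
  "stone x \<equiv> {F \<in> ultrafilters. x \<in> F}"

lemma convergent_subsequence:
  assumes "\<not> contains_infinite_independent_sequence E" and "\<And>n. a n \<in> E" and "infinite M"
  obtains M' where "infinite M'" and "M' \<subseteq> M" and "converges_on (\<lambda>n. stone (a n)) M' ultrafilters"
proof (rule rosenthal_dichotomy[OF assms(3), of "\<lambda>n. stone (a n)" ultrafilters])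
  fix \<nu> :: "nat \<Rightarrow> nat"
  assume cells: "\<And>\<sigma> k. \<exists>F\<in>ultrafilters. \<forall>i<k. F \<in> stone (a (\<nu> i)) \<longleftrightarrow> \<sigma> i"
  have "\<exists>F\<in>ultrafilters. \<forall>i<k. a (\<nu> i) \<in> F \<longleftrightarrow> \<sigma> i" for \<sigma> k
  proof -
    obtain F where "F \<in> ultrafilters" and "\<forall>i<k. F \<in> stone (a (\<nu> i)) \<longleftrightarrow> \<sigma> i"
      using cells[of k \<sigma>] by (rule bexE)
    then show ?thesis by (intro bexI[of _ F]) simp_all
  qed
  then have "independent_family UNIV (\<lambda>i. a (\<nu> i))"
    by (rule independent_familyI)
  then have "contains_infinite_independent_sequence E"
    unfolding contains_infinite_independent_sequence_def using assms(2)
    by (intro exI[of _ "\<lambda>i. a (\<nu> i)"]) auto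
  with assms(1) show thesis by blast
qed (rule that)

lemma common_convergent_subsequence:
  assumes "finite V" and "\<not> contains_infinite_independent_sequence E"
    and "\<And>n i. i \<in> V \<Longrightarrow> a n i \<in> E"
  shows "\<exists>M. infinite M \<and> (\<forall>i\<in>V. converges_on (\<lambda>n. stone (a n i)) M ultrafilters)"
  using assms(1,3)
proof (induction V)
  case empty
  show ?case using infinite_UNIV_nat by blast
next
  case (insert j V)
  then obtain M where M: "infinite M"
    "\<And>i. i \<in> V \<Longrightarrow> converges_on (\<lambda>n. stone (a n i)) M ultrafilters"
    by blast
  obtain M' where M': "infinite M'" "M' \<subseteq> M"
    "converges_on (\<lambda>n. stone (a n j)) M' ultrafilters"
    using convergent_subsequence[OF assms(2), of "\<lambda>n. a n j" M] insert.prems M(1) by auto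
  have fin: "finite (M' - M)"
    using M'(2) by (simp add: Diff_eq_empty_iff[THEN iffD2])
  have "converges_on (\<lambda>n. stone (a n i)) M' ultrafilters" if "i \<in> V" for i
    using M(2)[OF that] fin by (rule converges_on_almost_subset)
  with M' show ?case by blast
qed

lemma converges_on_poly_eval:
  assumes "\<And>i. i \<in> poly_vars p \<Longrightarrow> converges_on (\<lambda>n. stone (a n i)) M ultrafilters"
  shows "converges_on (\<lambda>n. stone (poly_eval p (a n))) M ultrafilters"
  unfolding converges_on_def
proof
  fix F :: "'b set" assume F: "F \<in> ultrafilters"
  have "finite {n\<in>M. a n i \<in> F} \<or> finite {n\<in>M. a n i \<notin> F}" if "i \<in> poly_vars p" for i
    using assms[OF that] F unfolding converges_on_def by simp
  then have "finite {n\<in>M. poly_eval p (a n) \<in> F} \<or> finite {n\<in>M. poly_eval p (a n) \<notin> F}"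
  proof (induction p)
    case (Var v)
    then show ?case by simp
  next
    case (Meet p q)
    have eqs: "{n\<in>M. poly_eval (Meet p q) (a n) \<in> F} =
        {n\<in>M. poly_eval p (a n) \<in> F} \<inter> {n\<in>M. poly_eval q (a n) \<in> F}"
      "{n\<in>M. poly_eval (Meet p q) (a n) \<notin> F} =
        {n\<in>M. poly_eval p (a n) \<notin> F} \<union> {n\<in>M. poly_eval q (a n) \<notin> F}"
      by (auto simp: ultrafilter_inf[OF F])
    have
      "finite {n\<in>M. poly_eval p (a n) \<in> F} \<or> finite {n\<in>M. poly_eval p (a n) \<notin> F}"
      "finite {n\<in>M. poly_eval q (a n) \<in> F} \<or> finite {n\<in>M. poly_eval q (a n) \<notin> F}"
      using Meet.IH Meet.prems by (meson bool_poly.set_intros(2,3))+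
    then show ?case unfolding eqs by auto
  next
    case (Join p q)
    have eqs: "{n\<in>M. poly_eval (Join p q) (a n) \<notin> F} =
        {n\<in>M. poly_eval p (a n) \<notin> F} \<inter> {n\<in>M. poly_eval q (a n) \<notin> F}"
      "{n\<in>M. poly_eval (Join p q) (a n) \<in> F} =
        {n\<in>M. poly_eval p (a n) \<in> F} \<union> {n\<in>M. poly_eval q (a n) \<in> F}"
      by (auto simp: ultrafilter_sup[OF F])
    have
      "finite {n\<in>M. poly_eval p (a n) \<in> F} \<or> finite {n\<in>M. poly_eval p (a n) \<notin> F}"
      "finite {n\<in>M. poly_eval q (a n) \<in> F} \<or> finite {n\<in>M. poly_eval q (a n) \<notin> F}"
      using Join.IH Join.prems by (meson bool_poly.set_intros(4,5))+
    then show ?case unfolding eqs by auto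
  next
    case (Compl p)
    then show ?case by (auto simp: ultrafilter_compl[OF F])
  qed
  then show "finite {n\<in>M. F \<in> stone (poly_eval p (a n))} \<or>
      finite {n\<in>M. F \<notin> stone (poly_eval p (a n))}"
    using F by simp
qed

text \<open>
  Independence allows any prescribed membership pattern, in particular one that alternates along
  the increasing enumeration \<open>e\<close> of indices from \<open>M\<close>. At such an ultrafilter the indicator
  functions diverge.
\<close>

lemma independent_not_convergent:
  assumes "independent_family UNIV b" and "infinite M"
  shows "\<not> converges_on (\<lambda>n. stone (b n)) M ultrafilters"
proof
  assume conv: "converges_on (\<lambda>n. stone (b n)) M ultrafilters"
  obtain e :: "nat \<Rightarrow> nat" where e: "strict_mono e" "\<And>n. e n \<in> M"
    using infinite_enumerate[OF assms(2)] by blast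
  have inj: "inj e"
    using e(1) by (rule strict_mono_imp_inj_on)
  obtain F where F: "F \<in> ultrafilters" "\<And>n. b n \<in> F \<longleftrightarrow> n \<in> range (\<lambda>k. e (2 * k))"
    using independent_family_ultrafilter[OF assms(1), of "range (\<lambda>k. e (2 * k))"] by metis
  have odd: "e (2 * k + 1) \<notin> range (\<lambda>k. e (2 * k))" for k
    using inj by (auto simp: inj_eq) presburger
  have "infinite (range (\<lambda>k. e (2 * k)))" "infinite (range (\<lambda>k. e (2 * k + 1)))"
    using inj by (auto intro!: range_inj_infinite injI simp: inj_eq)
  moreover have "range (\<lambda>k. e (2 * k)) \<subseteq> {n\<in>M. b n \<in> F}"
    "range (\<lambda>k. e (2 * k + 1)) \<subseteq> {n\<in>M. b n \<notin> F}"
    using e(2) F(2) odd by auto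
  ultimately have "infinite {n\<in>M. b n \<in> F}" "infinite {n\<in>M. b n \<notin> F}"
    using finite_subset by blast+
  then show False
    using conv F(1) unfolding converges_on_def by auto
qed

theorem theorem7p2:
  fixes E :: "'a::boolean_algebra set" and r :: nat and p :: "nat bool_poly"
  assumes "\<not> contains_infinite_independent_sequence E"
    and "poly_vars p \<subseteq> {1..r}"
  shows "\<not> contains_infinite_independent_sequence (poly_image r p E)"
proof
  assume "contains_infinite_independent_sequence (poly_image r p E)"
  then obtain b :: "nat \<Rightarrow> 'a" where b: "range b \<subseteq> poly_image r p E" "independent_family UNIV b"
    unfolding contains_infinite_independent_sequence_def by blast
  have "\<forall>n. \<exists>a. b n = poly_eval p a \<and> (\<forall>i\<in>{1..r}. a i \<in> E)"
    using b(1) unfolding poly_image_def by blast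
  then obtain a where a: "\<And>n. b n = poly_eval p (a n)" "\<And>n i. i \<in> {1..r} \<Longrightarrow> a n i \<in> E"
    by metis
  obtain M where "infinite M"
    and M: "\<And>i. i \<in> {1..r} \<Longrightarrow> converges_on (\<lambda>n. stone (a n i)) M ultrafilters"
    using common_convergent_subsequence[OF finite_atLeastAtMost assms(1), of 1 r a] a(2) by blast
  have "converges_on (\<lambda>n. stone (b n)) M ultrafilters"
    unfolding a(1) by (rule converges_on_poly_eval) (use M assms(2) in blast)
  with independent_not_convergent[OF b(2) \<open>infinite M\<close>] show False ..
qed

end
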